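(* (Duality Theorem) 1. For every QoS vector $\mathbf{u}$, $\Omega_{\mathrm{D}}(\mathbf{u})=\Omega_{\mathrm{U}}(\mathbf{u})$. 2. The feasible ranges of the downlink and of the virtual uplink systems are the same, i.e. $\Omega_{\mathrm{D}}=\Omega_{\mathrm{U}}$.
   Context: $K,L,M$ are positive integers; $\rho_f,\rho_r,\tau>0$ are real; $\beta_j^{[kl]}>0$ for $j,l\in\{1,\dots,L\}$, $k\in\{1,\dots,K\}$ (superscripts in square brackets are indices). Pairs $(k,l)$ range over $\{1,\dots,K\}\times\{1,\dots,L\}$. Let $\mathbf{b}^{[kl]}=(\beta_1^{[kl]},\dots,\beta_L^{[kl]})^T\in\mathbb{R}^L$ and $b_j^{[kln]}=\left(\frac{1}{\rho_f L}+\beta_j^{[kl]}\right)\left(\frac1{\rho_r\tau}+\sum_{s=1}^L\beta_j^{[ns]}\right)$. For $k,n\in\{1,\dots,K\}$, $l\in\{1,\dots,L\}$ let $\mathbf{Q}^{[kln]}\in\mathbb{R}^{L\times L}$ be $$\mathbf{Q}^{[kln]}=\tfrac1M\operatorname{diag}(b_1^{[kln]},\dots,b_L^{[kln]})+\delta_{kn}\,\mathbf{b}^{[kl]}\mathbf{b}^{[kl]T}.$$ Downlink: for nonzero beamforming vectors $\mathbf{v}^{[kl]}\in\mathbb{R}^L$ and powers $p^{[kl]}>0$, the relative signal power is $$\Gamma^{[kl]}=\frac{|\mathbf{b}^{[kl]T}\mathbf{v}^{[kl]}|^2p^{[kl]}}{\sum_{n=1}^K\sum_{j=1}^L\mathbf{v}^{[nj]T}\mathbf{Q}^{[kln]}\mathbf{v}^{[nj]}p^{[nj]}}.$$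 Virtual uplink: for $\mathbf{w}^{[kl]}\in\mathbb{R}^L$ with $\|\mathbf{w}^{[kl]}\|=1$ and powers $p_{\mathrm{U}}^{[kl]}>0$, $$\Gamma_{\mathrm{U}}^{[kl]}=\frac{p_{\mathrm{U}}^{[kl]}|\mathbf{b}^{[kl]T}\mathbf{w}^{[kl]}|^2}{\mathbf{w}^{[kl]T}\left(\sum_{n=1}^K\sum_{j=1}^L\mathbf{Q}^{[njk]}p_{\mathrm{U}}^{[nj]}\right)\mathbf{w}^{[kl]}}.$$ Feasible ranges: $\Omega_{\mathrm{D}}$ is the set of vectors $(\omega^{[kl]})_{k,l}\in\mathbb{R}^{KL}$ for which there exist beamforming vectors $\mathbf{v}^{[nv]}$ and powers $p^{[nv]}$ (for all $n,v$) with $\omega^{[kl]}\le\Gamma^{[kl]}$ for all $k,l$; $\Omega_{\mathrm{U}}$ is defined in the same way with $\mathbf{w}^{[nv]},p_{\mathrm{U}}^{[nv]},\Gamma_{\mathrm{U}}^{[kl]}$. A QoS vector is $\mathbf{u}=(u^{[kl]})_{k,l}\in\mathbb{R}^{KL}$ with positive entries and $\|\mathbf{u}\|=1$. The conditional feasible ranges are $\Omega_{\mathrm{D}}(\mathbf{u})=[0,\overline{\Gamma}]$ with $\overline{\Gamma}=\max_{\{\mathbf{v}^{[nv]},p^{[nv]}\}}\{\Gamma:\Gamma\le\Gamma^{[kl]}/u^{[kl]}\ \forall k,l\}$, and $\Omega_{\mathrm{U}}(\mathbf{u})=[0,\overline{\Gamma}_{\mathrm U}]$ with $\overline{\Gamma}_{\mathrm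 U}=\max_{\{\mathbf{w}^{[nv]},p_{\mathrm{U}}^{[nv]}\}}\{\Gamma:\Gamma\le\Gamma_{\mathrm{U}}^{[kl]}/u^{[kl]}\ \forall k,l\}$. *)

theory Defs
  imports "HOL-Analysis.Analysis"
begin

text \<open>
  The index sets \<open>{1..K}\<close> and \<open>{1..L}\<close> are finite types \<open>'k\<close> and \<open>'l\<close>, so that
  \<open>K = CARD('k)\<close> and \<open>L = CARD('l)\<close>. The coefficient written with lower index \<open>j\<close> and
  upper indices \<open>k l\<close> is \<open>\<beta> k l j\<close>.
\<close>

definition bvec :: "('k::finite \<Rightarrow> 'l::finite \<Rightarrow> 'l \<Rightarrow> real) \<Rightarrow> 'k \<Rightarrow> 'l \<Rightarrow> real^'l" where
  "bvec \<beta> k l = (\<chi> j. \<beta> k l j)"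

definition bcoef :: "real \<Rightarrow> real \<Rightarrow> real \<Rightarrow> ('k::finite \<Rightarrow> 'l::finite \<Rightarrow> 'l \<Rightarrow> real)
    \<Rightarrow> 'k \<Rightarrow> 'l \<Rightarrow> 'k \<Rightarrow> 'l \<Rightarrow> real" where
  "bcoef \<rho>f \<rho>r \<tau> \<beta> k l n j =
     (1 / (\<rho>f * real CARD('l)) + \<beta> k l j) * (1 / (\<rho>r * \<tau>) + (\<Sum>s\<in>UNIV. \<beta> n s j))"

definition Qmat :: "nat \<Rightarrow> real \<Rightarrow> real \<Rightarrow> real \<Rightarrow> ('k::finite \<Rightarrow> 'l::finite \<Rightarrow> 'l \<Rightarrow> real)
    \<Rightarrow> 'k \<Rightarrow> 'l \<Rightarrow> 'k \<Rightarrow> real^'l^'l" where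
  "Qmat M \<rho>f \<rho>r \<tau> \<beta> k l n =
     (1 / real M) *\<^sub>R (\<chi> i j. if i = j then bcoef \<rho>f \<rho>r \<tau> \<beta> k l n i else 0)
     + (if k = n then 1 else 0) *\<^sub>R (\<chi> i j. bvec \<beta> k l $ i * bvec \<beta> k l $ j)"

definition Gamma_D :: "nat \<Rightarrow> real \<Rightarrow> real \<Rightarrow> real \<Rightarrow> ('k::finite \<Rightarrow> 'l::finite \<Rightarrow> 'l \<Rightarrow> real)
    \<Rightarrow> ('k \<Rightarrow> 'l \<Rightarrow> real^'l) \<Rightarrow> ('k \<Rightarrow> 'l \<Rightarrow> real) \<Rightarrow> 'k \<Rightarrow> 'l \<Rightarrow> real" where
  "Gamma_D M \<rho>f \<rho>r \<tau> \<beta> v p k l =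
     \<bar>bvec \<beta> k l \<bullet> v k l\<bar>\<^sup>2 * p k l /
     (\<Sum>n\<in>UNIV. \<Sum>j\<in>UNIV. (v n j \<bullet> (Qmat M \<rho>f \<rho>r \<tau> \<beta> k l n *v v n j)) * p n j)"

definition Gamma_U :: "nat \<Rightarrow> real \<Rightarrow> real \<Rightarrow> real \<Rightarrow> ('k::finite \<Rightarrow> 'l::finite \<Rightarrow> 'l \<Rightarrow> real)
    \<Rightarrow> ('k \<Rightarrow> 'l \<Rightarrow> real^'l) \<Rightarrow> ('k \<Rightarrow> 'l \<Rightarrow> real) \<Rightarrow> 'k \<Rightarrow> 'l \<Rightarrow> real" where
  "Gamma_U M \<rho>f \<rho>r \<tau> \<beta> w p k l =
     p k l * \<bar>bvec \<beta> k l \<bullet> w k l\<bar>\<^sup>2 /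
     (w k l \<bullet> ((\<Sum>n\<in>UNIV. \<Sum>j\<in>UNIV. p n j *\<^sub>R Qmat M \<rho>f \<rho>r \<tau> \<beta> n j k) *v w k l))"

definition admissible_D ::
    "('k::finite \<Rightarrow> 'l::finite \<Rightarrow> real^'l) \<Rightarrow> ('k \<Rightarrow> 'l \<Rightarrow> real) \<Rightarrow> bool" where
  "admissible_D v p \<longleftrightarrow> (\<forall>k l. v k l \<noteq> 0) \<and> (\<forall>k l. p k l > 0)"

definition admissible_U ::
    "('k::finite \<Rightarrow> 'l::finite \<Rightarrow> real^'l) \<Rightarrow> ('k \<Rightarrow> 'l \<Rightarrow> real) \<Rightarrow> bool" where
  "admissible_U w p \<longleftrightarrow> (\<forall>k l. norm (w k l) = 1) \<and> (\<forall>k l. p k l > 0)"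

definition Omega_D :: "nat \<Rightarrow> real \<Rightarrow> real \<Rightarrow> real \<Rightarrow> ('k::finite \<Rightarrow> 'l::finite \<Rightarrow> 'l \<Rightarrow> real)
    \<Rightarrow> (real^('k \<times> 'l)) set" where
  "Omega_D M \<rho>f \<rho>r \<tau> \<beta> =
     {\<omega>. \<exists>v p. admissible_D v p \<and> (\<forall>k l. \<omega> $ (k, l) \<le> Gamma_D M \<rho>f \<rho>r \<tau> \<beta> v p k l)}"

definition Omega_U :: "nat \<Rightarrow> real \<Rightarrow> real \<Rightarrow> real \<Rightarrow> ('k::finite \<Rightarrow> 'l::finite \<Rightarrow> 'l \<Rightarrow> real)
    \<Rightarrow> (real^('k \<times> 'l)) set" where
  "Omega_U M \<rho>f \<rho>r \<tau> \<beta> =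
     {\<omega>. \<exists>w p. admissible_U w p \<and> (\<forall>k l. \<omega> $ (k, l) \<le> Gamma_U M \<rho>f \<rho>r \<tau> \<beta> w p k l)}"

definition QoS :: "real^('k::finite \<times> 'l::finite) \<Rightarrow> bool" where
  "QoS u \<longleftrightarrow> (\<forall>k l. u $ (k, l) > 0) \<and> norm u = 1"

text \<open>
  The maxima below are taken literally as greatest elements. They exist for every QoS vector:
  see \<open>Gamma_bar_D_exists\<close> and \<open>Gamma_bar_U_exists\<close>.
\<close>

definition Gamma_bar_D :: "nat \<Rightarrow> real \<Rightarrow> real \<Rightarrow> real \<Rightarrow> ('k::finite \<Rightarrow> 'l::finite \<Rightarrow> 'l \<Rightarrow> real)
    \<Rightarrow> real^('k \<times> 'l) \<Rightarrow> real" where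
  "Gamma_bar_D M \<rho>f \<rho>r \<tau> \<beta> u =
     (GREATEST \<Gamma>. \<exists>v p. admissible_D v p \<and>
        (\<forall>k l. \<Gamma> \<le> Gamma_D M \<rho>f \<rho>r \<tau> \<beta> v p k l / u $ (k, l)))"

definition Gamma_bar_U :: "nat \<Rightarrow> real \<Rightarrow> real \<Rightarrow> real \<Rightarrow> ('k::finite \<Rightarrow> 'l::finite \<Rightarrow> 'l \<Rightarrow> real)
    \<Rightarrow> real^('k \<times> 'l) \<Rightarrow> real" where
  "Gamma_bar_U M \<rho>f \<rho>r \<tau> \<beta> u =
     (GREATEST \<Gamma>. \<exists>w p. admissible_U w p \<and>
        (\<forall>k l. \<Gamma> \<le> Gamma_U M \<rho>f \<rho>r \<tau> \<beta> w p k l / u $ (k, l)))"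

definition Omega_D_cond :: "nat \<Rightarrow> real \<Rightarrow> real \<Rightarrow> real \<Rightarrow> ('k::finite \<Rightarrow> 'l::finite \<Rightarrow> 'l \<Rightarrow> real)
    \<Rightarrow> real^('k \<times> 'l) \<Rightarrow> real set" where
  "Omega_D_cond M \<rho>f \<rho>r \<tau> \<beta> u = {0..Gamma_bar_D M \<rho>f \<rho>r \<tau> \<beta> u}"

definition Omega_U_cond :: "nat \<Rightarrow> real \<Rightarrow> real \<Rightarrow> real \<Rightarrow> ('k::finite \<Rightarrow> 'l::finite \<Rightarrow> 'l \<Rightarrow> real)
    \<Rightarrow> real^('k \<times> 'l) \<Rightarrow> real set" where
  "Omega_U_cond M \<rho>f \<rho>r \<tau> \<beta> u = {0..Gamma_bar_U M \<rho>f \<rho>r \<tau> \<beta> u}"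


lemma continuous_on_Min_image:
  fixes f :: "'i \<Rightarrow> 'a::topological_space \<Rightarrow> real"
  assumes "finite I" "I \<noteq> {}" "\<And>i. i \<in> I \<Longrightarrow> continuous_on C (f i)"
  shows "continuous_on C (\<lambda>x. Min ((\<lambda>i. f i x) ` I))"
  using assms
proof (induction I rule: finite_ne_induct)
  case (singleton i)
  then show ?case by simp
next
  case (insert i I)
  then have "continuous_on C (\<lambda>x. min (f i x) (Min ((\<lambda>i. f i x) ` I)))"
    by (intro continuous_on_min) auto
  then show ?case using insert by simp
qed

lemma compact_unit_vecs: "compact {v :: real^'l^'i. \<forall>i. norm (v $ i) = 1}"
proof -
  have "closed (\<Inter>i. {v :: real^'l^'i. norm (v $ i) = 1})"
    by (intro closed_INT ballI closed_Collect_eq continuous_intros)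
  moreover have "{v :: real^'l^'i. \<forall>i. norm (v $ i) = 1} = (\<Inter>i. {v. norm (v $ i) = 1})"
    by auto
  moreover have "bounded {v :: real^'l^'i. \<forall>i. norm (v $ i) = 1}"
  proof (rule boundedI)
    fix v :: "real^'l^'i" assume "v \<in> {v. \<forall>i. norm (v $ i) = 1}"
    then have "(\<Sum>i\<in>UNIV. norm (v $ i)) = real CARD('i)" by simp
    then show "norm v \<le> real CARD('i)"
      using norm_le_l1_cart L2_set_le_sum[of UNIV "\<lambda>i. norm (v $ i)"]
      by (simp add: norm_vec_def)
  qed
  ultimately show ?thesis by (simp add: compact_eq_bounded_closed)
qed

lemma compact_prob_simplex:
  "compact {p :: real^'i. (\<forall>i. 0 \<le> p $ i) \<and> (\<Sum>i\<in>UNIV. p $ i) = 1}"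
proof -
  have "closed ((\<Inter>i. {p :: real^'i. 0 \<le> p $ i}) \<inter> {p. (\<Sum>i\<in>UNIV. p $ i) = 1})"
    by (intro closed_Int closed_INT ballI closed_Collect_eq closed_Collect_le continuous_intros)
  moreover have "{p :: real^'i. (\<forall>i. 0 \<le> p $ i) \<and> (\<Sum>i\<in>UNIV. p $ i) = 1}
      = (\<Inter>i. {p. 0 \<le> p $ i}) \<inter> {p. (\<Sum>i\<in>UNIV. p $ i) = 1}" by auto
  moreover have "bounded {p :: real^'i. (\<forall>i. 0 \<le> p $ i) \<and> (\<Sum>i\<in>UNIV. p $ i) = 1}"
  proof (rule boundedI)
    fix p :: "real^'i" assume "p \<in> {p. (\<forall>i. 0 \<le> p $ i) \<and> (\<Sum>i\<in>UNIV. p $ i) = 1}"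
    then show "norm p \<le> 1" using norm_le_l1_cart[of p] by simp
  qed
  ultimately show ?thesis by (simp add: compact_eq_bounded_closed)
qed

lemma greatest_ratio_exists:
  fixes N :: "'i::finite \<Rightarrow> real^'l^'i \<Rightarrow> real" and B :: "'i \<Rightarrow> 'i \<Rightarrow> real^'l^'i \<Rightarrow> real"
  assumes contN: "\<And>i. continuous_on UNIV (N i)"
    and contB: "\<And>i j. continuous_on UNIV (B i j)"
    and Bpos: "\<And>v i j. \<forall>i. norm (v $ i) = 1 \<Longrightarrow> 0 < B i j v"
    and v0: "\<forall>i. norm (v0 $ i) = 1" "\<And>i. 0 < N i v0"
    and upos: "\<And>i. 0 < (u i :: real)"
  defines "F \<equiv> \<lambda>v (p :: real^'i) i. N i v * p $ i / (\<Sum>j\<in>UNIV. B i j v * p $ j) / u i"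
  shows "\<exists>m v p. (\<forall>i. norm (v $ i) = 1) \<and> (\<forall>i. 0 < p $ i) \<and> (\<forall>i. m \<le> F v p i) \<and>
     (\<forall>m' v p. (\<forall>i. norm (v $ i) = 1) \<longrightarrow> (\<forall>i. 0 < p $ i) \<longrightarrow> (\<forall>i. m' \<le> F v p i) \<longrightarrow> m' \<le> m)"
proof -
  define C where "C = {v :: real^'l^'i. \<forall>i. norm (v $ i) = 1}
     \<times> {p :: real^'i. (\<forall>i. 0 \<le> p $ i) \<and> (\<Sum>i\<in>UNIV. p $ i) = 1}"
  have cC: "compact C"
    unfolding C_def by (intro compact_Times compact_unit_vecs compact_prob_simplex)
  have den: "0 < (\<Sum>j\<in>UNIV. B i j v * p $ j)" if "(v, p) \<in> C" for v p i
  proof -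
    have p: "\<And>j. 0 \<le> p $ j" "(\<Sum>j\<in>UNIV. p $ j) = 1" and B: "\<And>j. 0 < B i j v"
      using that Bpos by (auto simp: C_def)
    obtain j where "p $ j \<noteq> 0" using p(2) by (metis sum.neutral zero_neq_one)
    then have "0 < B i j v * p $ j" using p(1)[of j] B[of j] by simp
    moreover have "\<And>j. 0 \<le> B i j v * p $ j"
      using p(1) B by (simp add: less_imp_le)
    ultimately show ?thesis by (intro sum_pos2[of UNIV j]) auto
  qed
  define h where "h = (\<lambda>x. Min (range (\<lambda>i. F (fst x) (snd x) i)))"
  have contN': "continuous_on C (\<lambda>x. N i (fst x))" for i
    by (rule continuous_on_compose2[OF contN continuous_on_fst[OF continuous_on_id]]) simp
  have contB': "continuous_on C (\<lambda>x. B i j (fst x))" for i j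
    by (rule continuous_on_compose2[OF contB continuous_on_fst[OF continuous_on_id]]) simp
  have "continuous_on C h"
    unfolding h_def
  proof (rule continuous_on_Min_image)
    fix i
    show "continuous_on C (\<lambda>x. F (fst x) (snd x) i)"
      unfolding F_def
      by (intro continuous_intros contN' contB') (use den upos in \<open>force simp: less_imp_neq[symmetric]\<close>)+
  qed auto
  define p0 :: "real^'i" where "p0 = (\<chi> i. 1 / real CARD('i))"
  have x0: "(v0, p0) \<in> C" using v0 by (simp add: C_def p0_def)
  obtain v p where vp: "(v, p) \<in> C" and max: "\<And>y. y \<in> C \<Longrightarrow> h y \<le> h (v, p)"
    using continuous_attains_sup[OF cC _ \<open>continuous_on C h\<close>] x0 by (metis empty_iff surj_pair)
  have "F v0 p0 i > 0" for i
    unfolding F_def using den[OF x0] v0(2) upos by (simp add: p0_def)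
  then have "0 < h (v0, p0)" by (simp add: h_def)
  then have hpos: "0 < h (v, p)" using max[OF x0] by simp
  have hle: "h (v, p) \<le> F v p i" for i by (simp add: h_def)
  have ppos: "0 < p $ i" for i
  proof -
    have "0 \<le> p $ i" using vp by (simp add: C_def)
    moreover have "p $ i \<noteq> 0"
    proof
      assume "p $ i = 0"
      then have "F v p i = 0" by (simp add: F_def)
      then show False using hle[of i] hpos by simp
    qed
    ultimately show ?thesis by simp
  qed
  have "m' \<le> h (v, p)"
    if w: "\<forall>i. norm (w $ i) = 1" and q: "\<forall>i. 0 < q $ i" and m': "\<forall>i. m' \<le> F w q i" for m' w q
  proof -
    define s where "s = (\<Sum>i\<in>UNIV. q $ i)"
    have s: "0 < s" unfolding s_def using q by (intro sum_pos) auto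
    define q' where "q' = (\<chi> i. q $ i / s)"
    have q': "(w, q') \<in> C"
      using w q s by (simp add: C_def q'_def less_imp_le sum_divide_distrib[symmetric] s_def[symmetric])
    have "F w q' i = F w q i" for i
    proof -
      have "(\<Sum>j\<in>UNIV. B i j w * q' $ j) = (\<Sum>j\<in>UNIV. B i j w * q $ j) / s"
        by (simp add: q'_def sum_divide_distrib)
      then show ?thesis using s by (simp add: F_def q'_def)
    qed
    then have "m' \<le> h (w, q')" using m' by (simp add: h_def)
    then show ?thesis using max[OF q'] by simp
  qed
  moreover have "\<forall>i. norm (v $ i) = 1" using vp by (simp add: C_def)
  ultimately show ?thesis using ppos hle by blast
qed

lemma continuous_on_quadratic_form:
  "continuous_on S (\<lambda>v :: real^'l^'i. v $ i \<bullet> (A *v v $ i))"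
  by (intro continuous_on_inner continuous_on_component continuous_on_id
      bounded_linear.continuous_on[OF matrix_vector_mul_bounded_linear])

lemma Qmat_quadratic_form:
  fixes v :: "real^'l"
  shows "v \<bullet> (Qmat M \<rho>f \<rho>r \<tau> \<beta> k l n *v v) =
     (\<Sum>j\<in>UNIV. bcoef \<rho>f \<rho>r \<tau> \<beta> k l n j * (v $ j)\<^sup>2) / real M
     + (if k = n then (bvec \<beta> k l \<bullet> v)\<^sup>2 else 0)"
proof -
  have 1: "v \<bullet> ((\<chi> i j. if i = j then d i else 0) *v v) = (\<Sum>j\<in>UNIV. d j * (v $ j)\<^sup>2)"
    for d :: "'l \<Rightarrow> real"
  proof -
    have "((\<chi> i j. if i = j then d i else 0) *v v) = (\<chi> i. d i * v $ i)"
      by (simp add: matrix_vector_mult_def vec_eq_iff if_distrib[of "\<lambda>x. x * _"] cong: if_cong)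
    then show ?thesis by (simp add: inner_vec_def power2_eq_square ac_simps)
  qed
  have 2: "v \<bullet> ((\<chi> i j. b $ i * b $ j) *v v) = (b \<bullet> v)\<^sup>2" for b :: "real^'l"
    by (simp add: inner_vec_def matrix_vector_mult_def power2_eq_square sum_product
        sum_distrib_left ac_simps)
  show ?thesis
    unfolding Qmat_def
    by (simp add: matrix_vector_mult_add_rdistrib inner_add_right scaleR_matrix_vector_assoc[symmetric] 1 2)
qed

lemma Qmat_pos_def:
  assumes "M > 0" "\<rho>f > 0" "\<rho>r > 0" "\<tau> > 0" "\<And>k l j. \<beta> k l j > 0" "v \<noteq> 0"
  shows "0 < v \<bullet> (Qmat M \<rho>f \<rho>r \<tau> \<beta> k l n *v v)"
proof -
  have b: "0 < bcoef \<rho>f \<rho>r \<tau> \<beta> k l n j" for j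
    unfolding bcoef_def using assms by (intro mult_pos_pos add_pos_nonneg sum_nonneg add_nonneg_pos) (auto simp: less_imp_le)
  obtain j where "v $ j \<noteq> 0" using \<open>v \<noteq> 0\<close> by (auto simp: vec_eq_iff)
  then have "0 < (\<Sum>j\<in>UNIV. bcoef \<rho>f \<rho>r \<tau> \<beta> k l n j * (v $ j)\<^sup>2)"
    using b by (intro sum_pos2[of UNIV j]) (auto simp: less_imp_le)
  then show ?thesis
    using \<open>M > 0\<close> by (auto simp: Qmat_quadratic_form intro: add_pos_nonneg)
qed

lemma sum_pairs: "(\<Sum>x\<in>UNIV. f x) = (\<Sum>n\<in>UNIV. \<Sum>j\<in>UNIV. f (n, j))"
  by (simp add: sum.cartesian_product)

lemma Gamma_bar_D_exists:
  fixes \<beta> :: "'k::finite \<Rightarrow> 'l::finite \<Rightarrow> 'l \<Rightarrow> real"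
  assumes pos: "M > 0" "\<rho>f > 0" "\<rho>r > 0" "\<tau> > 0" "\<And>k l j. \<beta> k l j > 0" and u: "QoS u"
  defines "P \<equiv> \<lambda>\<Gamma>. \<exists>v p. admissible_D v p \<and>
        (\<forall>k l. \<Gamma> \<le> Gamma_D M \<rho>f \<rho>r \<tau> \<beta> v p k l / u $ (k, l))"
  shows "\<exists>m. P m \<and> (\<forall>m'. P m' \<longrightarrow> m' \<le> m)"
proof -
  define N where "N = (\<lambda>(i :: 'k \<times> 'l) (v :: real^'l^('k \<times> 'l)).
     \<bar>bvec \<beta> (fst i) (snd i) \<bullet> v $ i\<bar>\<^sup>2)"
  define B where "B = (\<lambda>(i :: 'k \<times> 'l) (j :: 'k \<times> 'l) (v :: real^'l^('k \<times> 'l)).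
     v $ j \<bullet> (Qmat M \<rho>f \<rho>r \<tau> \<beta> (fst i) (snd i) (fst j) *v v $ j))"
  define v0 :: "real^'l^('k \<times> 'l)" where "v0 = (\<chi> i. sgn (bvec \<beta> (fst i) (snd i)))"
  have bn: "bvec \<beta> k l \<noteq> 0" for k l
    using pos(5) by (metis bvec_def less_irrefl vec_lambda_beta zero_index)
  have "\<exists>m v p. (\<forall>i. norm (v $ i) = 1) \<and> (\<forall>i. 0 < p $ i) \<and>
      (\<forall>i. m \<le> N i v * p $ i / (\<Sum>j\<in>UNIV. B i j v * p $ j) / u $ i) \<and>
     (\<forall>m' v p. (\<forall>i. norm (v $ i) = 1) \<longrightarrow> (\<forall>i. 0 < p $ i) \<longrightarrow>
      (\<forall>i. m' \<le> N i v * p $ i / (\<Sum>j\<in>UNIV. B i j v * p $ j) / u $ i) \<longrightarrow> m' \<le> m)"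
  proof (rule greatest_ratio_exists)
    show "continuous_on UNIV (N i)" for i unfolding N_def by (intro continuous_intros)
    show "continuous_on UNIV (B i j)" for i j
      unfolding B_def by (rule continuous_on_quadratic_form)
    show "0 < B i j v" if "\<forall>i. norm (v $ i) = 1" for i j v
    proof -
      have "v $ j \<noteq> 0" using that by (metis norm_zero zero_neq_one)
      then show ?thesis unfolding B_def by (intro Qmat_pos_def pos)
    qed
    show "\<forall>i. norm (v0 $ i) = 1" by (simp add: v0_def norm_sgn bn)
    show "0 < N i v0" for i using bn by (simp add: N_def v0_def sgn_div_norm)
    show "0 < u $ i" for i using u by (cases i) (simp add: QoS_def)
  qed
  then obtain m v p where v: "\<forall>i. norm (v $ i) = 1" and p: "\<forall>i. 0 < p $ i"
    and m: "\<forall>i. m \<le> N i v * p $ i / (\<Sum>j\<in>UNIV. B i j v * p $ j) / u $ i"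
    and max: "\<And>m' v p. (\<forall>i. norm (v $ i) = 1) \<Longrightarrow> (\<forall>i. 0 < p $ i) \<Longrightarrow>
      (\<forall>i. m' \<le> N i v * p $ i / (\<Sum>j\<in>UNIV. B i j v * p $ j) / u $ i) \<Longrightarrow> m' \<le> m"
    by blast
  have "P m"
    unfolding P_def
  proof (intro exI conjI)
    have "v $ i \<noteq> 0" for i using v by (metis norm_zero zero_neq_one)
    then show "admissible_D (\<lambda>k l. v $ (k, l)) (\<lambda>k l. p $ (k, l))"
      using p by (simp add: admissible_D_def)
    show "\<forall>k l. m \<le> Gamma_D M \<rho>f \<rho>r \<tau> \<beta> (\<lambda>k l. v $ (k, l)) (\<lambda>k l. p $ (k, l)) k l / u $ (k, l)"
      using m by (auto simp: Gamma_D_def N_def B_def sum_pairs)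
  qed
  moreover have "m' \<le> m" if "P m'" for m'
  proof -
    obtain w q where w: "\<And>k l. w k l \<noteq> 0" and q: "\<And>k l. q k l > 0"
      and m': "\<And>k l. m' \<le> Gamma_D M \<rho>f \<rho>r \<tau> \<beta> w q k l / u $ (k, l)"
      using \<open>P m'\<close> by (auto simp: P_def admissible_D_def)
    show ?thesis
    proof (rule max)
      let ?v = "\<chi> i. sgn (w (fst i) (snd i))"
      let ?p = "\<chi> i. q (fst i) (snd i) * (norm (w (fst i) (snd i)))\<^sup>2"
      show "\<forall>i. norm (?v $ i) = 1" by (simp add: norm_sgn w)
      show "\<forall>i. 0 < ?p $ i" by (simp add: w q)
      have num: "N (k, l) ?v * ?p $ (k, l) = \<bar>bvec \<beta> k l \<bullet> w k l\<bar>\<^sup>2 * q k l" for k l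
        using w[of k l] by (simp add: N_def sgn_div_norm field_simps power2_eq_square)
      have den: "B (k, l) (n, j) ?v * ?p $ (n, j)
          = (w n j \<bullet> (Qmat M \<rho>f \<rho>r \<tau> \<beta> k l n *v w n j)) * q n j" for k l n j
        using w[of n j]
        by (simp add: B_def sgn_div_norm matrix_vector_mult_scaleR field_simps power2_eq_square)
      show "\<forall>i. m' \<le> N i ?v * ?p $ i / (\<Sum>j\<in>UNIV. B i j ?v * ?p $ j) / u $ i"
        using m' unfolding split_paired_All sum_pairs num den by (simp add: Gamma_D_def)
    qed
  qed
  ultimately show ?thesis by blast
qed

lemma Gamma_bar_U_exists:
  fixes \<beta> :: "'k::finite \<Rightarrow> 'l::finite \<Rightarrow> 'l \<Rightarrow> real"
  assumes pos: "M > 0" "\<rho>f > 0" "\<rho>r > 0" "\<tau> > 0" "\<And>k l j. \<beta> k l j > 0" and u: "QoS u"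
  defines "P \<equiv> \<lambda>\<Gamma>. \<exists>w p. admissible_U w p \<and>
        (\<forall>k l. \<Gamma> \<le> Gamma_U M \<rho>f \<rho>r \<tau> \<beta> w p k l / u $ (k, l))"
  shows "\<exists>m. P m \<and> (\<forall>m'. P m' \<longrightarrow> m' \<le> m)"
proof -
  define N where "N = (\<lambda>(i :: 'k \<times> 'l) (v :: real^'l^('k \<times> 'l)).
     \<bar>bvec \<beta> (fst i) (snd i) \<bullet> v $ i\<bar>\<^sup>2)"
  define B where "B = (\<lambda>(i :: 'k \<times> 'l) (j :: 'k \<times> 'l) (v :: real^'l^('k \<times> 'l)).
     v $ i \<bullet> (Qmat M \<rho>f \<rho>r \<tau> \<beta> (fst j) (snd j) (fst i) *v v $ i))"
  define v0 :: "real^'l^('k \<times> 'l)" where "v0 = (\<chi> i. sgn (bvec \<beta> (fst i) (snd i)))"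
  have bn: "bvec \<beta> k l \<noteq> 0" for k l
    using pos(5) by (metis bvec_def less_irrefl vec_lambda_beta zero_index)
  have "\<exists>m v p. (\<forall>i. norm (v $ i) = 1) \<and> (\<forall>i. 0 < p $ i) \<and>
      (\<forall>i. m \<le> N i v * p $ i / (\<Sum>j\<in>UNIV. B i j v * p $ j) / u $ i) \<and>
     (\<forall>m' v p. (\<forall>i. norm (v $ i) = 1) \<longrightarrow> (\<forall>i. 0 < p $ i) \<longrightarrow>
      (\<forall>i. m' \<le> N i v * p $ i / (\<Sum>j\<in>UNIV. B i j v * p $ j) / u $ i) \<longrightarrow> m' \<le> m)"
  proof (rule greatest_ratio_exists)
    show "continuous_on UNIV (N i)" for i unfolding N_def by (intro continuous_intros)
    show "continuous_on UNIV (B i j)" for i j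
      unfolding B_def by (rule continuous_on_quadratic_form)
    show "0 < B i j v" if "\<forall>i. norm (v $ i) = 1" for i j v
    proof -
      have "v $ i \<noteq> 0" using that by (metis norm_zero zero_neq_one)
      then show ?thesis unfolding B_def by (intro Qmat_pos_def pos)
    qed
    show "\<forall>i. norm (v0 $ i) = 1" by (simp add: v0_def norm_sgn bn)
    show "0 < N i v0" for i using bn by (simp add: N_def v0_def sgn_div_norm)
    show "0 < u $ i" for i using u by (cases i) (simp add: QoS_def)
  qed
  then obtain m v p where v: "\<forall>i. norm (v $ i) = 1" and p: "\<forall>i. 0 < p $ i"
    and m: "\<forall>i. m \<le> N i v * p $ i / (\<Sum>j\<in>UNIV. B i j v * p $ j) / u $ i"
    and max: "\<And>m' v p. (\<forall>i. norm (v $ i) = 1) \<Longrightarrow> (\<forall>i. 0 < p $ i) \<Longrightarrow>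
      (\<forall>i. m' \<le> N i v * p $ i / (\<Sum>j\<in>UNIV. B i j v * p $ j) / u $ i) \<Longrightarrow> m' \<le> m"
    by blast
  have lin: "x \<bullet> ((\<Sum>n\<in>UNIV. \<Sum>j\<in>UNIV. q n j *\<^sub>R A n j) *v x)
      = (\<Sum>n\<in>UNIV. \<Sum>j\<in>UNIV. (x \<bullet> (A n j *v x)) * q n j)"
    for x :: "real^'l" and q :: "'k \<Rightarrow> 'l \<Rightarrow> real" and A :: "'k \<Rightarrow> 'l \<Rightarrow> real^'l^'l"
  proof -
    have "linear (\<lambda>A :: real^'l^'l. x \<bullet> (A *v x))"
      by (rule linearI)
        (simp_all add: matrix_vector_mult_add_rdistrib inner_add_right scaleR_matrix_vector_assoc[symmetric])
    then show ?thesis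
      by (simp only: linear_sum[OF \<open>linear _\<close>] linear_scale[OF \<open>linear _\<close>] real_scaleR_def mult.commute)
  qed
  have "P m"
    unfolding P_def
  proof (intro exI conjI)
    show "admissible_U (\<lambda>k l. v $ (k, l)) (\<lambda>k l. p $ (k, l))"
      using p v by (simp add: admissible_U_def)
    show "\<forall>k l. m \<le> Gamma_U M \<rho>f \<rho>r \<tau> \<beta> (\<lambda>k l. v $ (k, l)) (\<lambda>k l. p $ (k, l)) k l / u $ (k, l)"
      using m by (auto simp: Gamma_U_def lin N_def B_def sum_pairs mult.commute)
  qed
  moreover have "m' \<le> m" if "P m'" for m'
  proof -
    obtain w q where w: "\<And>k l. norm (w k l) = 1" and q: "\<And>k l. q k l > 0"
      and m': "\<And>k l. m' \<le> Gamma_U M \<rho>f \<rho>r \<tau> \<beta> w q k l / u $ (k, l)"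
      using \<open>P m'\<close> by (auto simp: P_def admissible_U_def)
    show ?thesis
    proof (rule max)
      let ?v = "\<chi> i. w (fst i) (snd i)" and ?p = "\<chi> i. q (fst i) (snd i)"
      show "\<forall>i. norm (?v $ i) = 1" by (simp add: w)
      show "\<forall>i. 0 < ?p $ i" by (simp add: q)
      show "\<forall>i. m' \<le> N i ?v * ?p $ i / (\<Sum>j\<in>UNIV. B i j ?v * ?p $ j) / u $ i"
        using m' unfolding split_paired_All sum_pairs
        by (simp add: Gamma_U_def lin N_def B_def mult.commute)
    qed
  qed
  ultimately show ?thesis by blast
qed

end

theory Submission
  imports Defs
begin

text \<open>
  For fixed beamforming vectors, both systems are governed by one positive matrix \<open>B\<close>, the
  uplink by its transpose. Downlink powers \<open>p\<close> form a positive right null vector of \<open>diag d - B\<close>,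
  where \<open>d i\<close> is the quotient of the \<open>i\<close>-th interference term by \<open>p i\<close>. This matrix is singular,
  so it has a left null vector as well, and by positivity that vector can be chosen positive.
  Using it as uplink powers gives exactly the same signal powers; the converse is symmetric.
  Hence both systems attain the same vectors of signal powers.
\<close>

lemma det_eq_0_iff_null_vector:
  fixes A :: "real^'n^'n"
  shows "det A = 0 \<longleftrightarrow> (\<exists>x. x \<noteq> 0 \<and> A *v x = 0)"
  using invertible_det_nz[of A] matrix_left_invertible_ker[of A] invertible_left_inverse[of A]
  by blast

text \<open>An instance of Perron-Frobenius reasoning: a left null vector of unknown sign exists
  because the determinant vanishes, and its entrywise absolute values turn out to be a positive
  one.\<close>

lemma positive_left_null_vector:
  fixes B :: "'i::finite \<Rightarrow> 'i \<Rightarrow> real"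
  assumes B: "\<And>i j. B i j > 0" and p: "\<And>i. p i > 0"
    and eq: "\<And>i. d i * p i = (\<Sum>j\<in>UNIV. B i j * p j)"
  obtains q where "\<And>i. q i > 0" "\<And>i. d i * q i = (\<Sum>j\<in>UNIV. B j i * q j)"
proof -
  define A :: "real^'i^'i" where "A = (\<chi> i j. (if i = j then d i else 0) - B i j)"
  \<comment> \<open>Positivity lets \<open>d i\<close> move inside the absolute value in
    \<open>le\<close>.\<close>
  have d: "d i > 0" for i
  proof -
    have "d i * p i > 0"
      unfolding eq using B p by (intro sum_pos) auto
    then show ?thesis
      using p[of i] by (simp add: zero_less_mult_iff)
  qed
  have "A *v (\<chi> i. p i) = 0"
    by (simp add: A_def vec_eq_iff matrix_vector_mult_def left_diff_distrib sum_subtractf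
        if_distrib[of "\<lambda>x. x * _"] eq cong: if_cong)
  moreover have "(\<chi> i. p i) \<noteq> 0"
    using p by (metis less_irrefl vec_lambda_beta zero_index)
  ultimately have "det A = 0"
    using det_eq_0_iff_null_vector by blast
  then obtain x where x: "x \<noteq> 0" "transpose A *v x = 0"
    by (metis det_eq_0_iff_null_vector det_transpose)
  have dx: "d i * x $ i = (\<Sum>j\<in>UNIV. B j i * x $ j)" for i
  proof -
    have "(transpose A *v x) $ i = d i * x $ i - (\<Sum>j\<in>UNIV. B j i * x $ j)"
      by (simp add: A_def transpose_def matrix_vector_mult_def left_diff_distrib sum_subtractf
          if_distrib[of "\<lambda>x. x * _"] cong: if_cong)
    then show ?thesis
      using x by simp
  qed
  define s where "s i = (\<Sum>j\<in>UNIV. B j i * \<bar>x $ j\<bar>)" for i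
  have le: "d i * \<bar>x $ i\<bar> \<le> s i" for i
  proof -
    have "d i * \<bar>x $ i\<bar> = \<bar>\<Sum>j\<in>UNIV. B j i * x $ j\<bar>"
      using d[of i] by (simp flip: dx add: abs_mult)
    also have "\<dots> \<le> (\<Sum>j\<in>UNIV. \<bar>B j i * x $ j\<bar>)"
      by (rule sum_abs)
    also have "\<dots> = s i"
      using B by (simp add: s_def abs_mult less_imp_le)
    finally show ?thesis .
  qed
  \<comment> \<open>Pairing with \<open>p\<close> forces equality in every \<open>le\<close>, so the absolute values are a null vector too.\<close>
  have "(\<Sum>i\<in>UNIV. p i * s i) = (\<Sum>j\<in>UNIV. \<bar>x $ j\<bar> * (\<Sum>i\<in>UNIV. B j i * p i))"
    unfolding s_def sum_distrib_left by (subst sum.swap) (simp add: ac_simps)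
  also have "\<dots> = (\<Sum>j\<in>UNIV. p j * (d j * \<bar>x $ j\<bar>))"
    unfolding eq[symmetric] by (simp add: mult_ac)
  finally have "(\<Sum>i\<in>UNIV. p i * (s i - d i * \<bar>x $ i\<bar>)) = 0"
    by (simp add: right_diff_distrib sum_subtractf)
  then have "p i * (s i - d i * \<bar>x $ i\<bar>) = 0" for i
    using le p by (subst (asm) sum_nonneg_eq_0_iff) (auto simp: less_imp_le)
  then have s: "d i * \<bar>x $ i\<bar> = s i" for i
    using p[of i] by (metis eq_iff_diff_eq_0 less_irrefl mult_eq_0_iff)
  obtain j where j: "x $ j \<noteq> 0"
    using x(1) by (auto simp: vec_eq_iff)
  \<comment> \<open>A single nonzero entry of \<open>x\<close> makes every \<open>s i\<close>
    positive, since all entries of \<open>B\<close> are; by \<open>s\<close> no entry of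
    \<open>x\<close> can then vanish.\<close>
  have "s i > 0" for i
    unfolding s_def using B j by (intro sum_pos2[of UNIV j]) (auto simp: less_imp_le)
  then have "\<bar>x $ i\<bar> > 0" for i
    by (metis s mult_zero_right less_irrefl zero_less_abs_iff abs_zero)
  then show thesis
    using that[of "\<lambda>i. \<bar>x $ i\<bar>"] s unfolding s_def by blast
qed

text \<open>The beamforming gains are common to both systems, so only these quotients of power by
  interference have to agree. Taking \<open>d\<close> as their reciprocals turns the equality into
  the null vector equation.\<close>

lemma positive_dual_weights:
  fixes B :: "'i::finite \<Rightarrow> 'i \<Rightarrow> real"
  assumes B: "\<And>i j. B i j > 0" and p: "\<And>i. p i > 0"
  obtains q where "\<And>i. q i > 0"
    "\<And>i. q i / (\<Sum>j\<in>UNIV. B j i * q j) = p i / (\<Sum>j\<in>UNIV. B i j * p j)"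
proof -
  define d where "d i = (\<Sum>j\<in>UNIV. B i j * p j) / p i" for i
  have "d i * p i = (\<Sum>j\<in>UNIV. B i j * p j)" for i
    using p[of i] by (simp add: d_def)
  then obtain q where q: "\<And>i. q i > 0" "\<And>i. d i * q i = (\<Sum>j\<in>UNIV. B j i * q j)"
    using positive_left_null_vector[of B p d] B p by blast
  have "q i / (\<Sum>j\<in>UNIV. B j i * q j) = p i / (\<Sum>j\<in>UNIV. B i j * p j)" for i
    using q(1)[of i] by (simp flip: q(2) add: d_def)
  with q(1) show thesis
    using that by blast
qed

text \<open>Brings the uplink denominator into the form of a linear combination of powers.\<close>

lemma inner_sum_matrix_mult:
  fixes x :: "real^'l" and A :: "'k \<Rightarrow> 'j \<Rightarrow> real^'l^'l"
  shows "x \<bullet> ((\<Sum>n\<in>N. \<Sum>j\<in>J. q n j *\<^sub>R A n j) *v x)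
    = (\<Sum>n\<in>N. \<Sum>j\<in>J. (x \<bullet> (A n j *v x)) * q n j)"
proof -
  have lin: "linear (\<lambda>A :: real^'l^'l. x \<bullet> (A *v x))"
    by (rule linearI)
      (simp_all add: matrix_vector_mult_add_rdistrib inner_add_right scaleR_matrix_vector_assoc[symmetric])
  show ?thesis
    by (simp only: linear_sum[OF lin] linear_scale[OF lin] real_scaleR_def mult.commute)
qed

text \<open>Each uplink ratio involves only its own beamformer, quadratically above and below, so
  the factor cancels. This reconciles nonzero downlink vectors with unit uplink vectors.\<close>

lemma Gamma_U_scale:
  assumes "\<And>k l. c k l \<noteq> 0"
  shows "Gamma_U M \<rho>f \<rho>r \<tau> \<beta> (\<lambda>k l. c k l *\<^sub>R w k l) q = Gamma_U M \<rho>f \<rho>r \<tau> \<beta> w q"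
  using assms
  by (simp add: fun_eq_iff Gamma_U_def matrix_vector_mult_scaleR power_mult_distrib
      power2_eq_square[of "c _ _"] mult.assoc mult.left_commute[of "q _ _"])

context
  fixes \<beta> :: "'k::finite \<Rightarrow> 'l::finite \<Rightarrow> 'l \<Rightarrow> real" and M :: nat and \<rho>f \<rho>r \<tau> :: real
  assumes pos: "M > 0" "\<rho>f > 0" "\<rho>r > 0" "\<tau> > 0" "\<And>k l j. \<beta> k l j > 0"
begin

text \<open>The positive matrix \<open>B\<close>: the coefficient of the power of \<open>y\<close>
  in the downlink denominator of \<open>x\<close>. The uplink denominator of \<open>x\<close> has
  \<open>coupling v y x\<close> instead.\<close>

definition coupling :: "('k \<Rightarrow> 'l \<Rightarrow> real^'l) \<Rightarrow> 'k \<times> 'l \<Rightarrow> 'k \<times> 'l \<Rightarrow> real" where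
  "coupling v x y =
     v (fst y) (snd y) \<bullet> (Qmat M \<rho>f \<rho>r \<tau> \<beta> (fst x) (snd x) (fst y) *v v (fst y) (snd y))"

lemma coupling_pos: "(\<And>k l. v k l \<noteq> 0) \<Longrightarrow> coupling v x y > 0"
  unfolding coupling_def by (intro Qmat_pos_def pos) auto

lemma Gamma_D_coupling:
  "Gamma_D M \<rho>f \<rho>r \<tau> \<beta> v p k l = \<bar>bvec \<beta> k l \<bullet> v k l\<bar>\<^sup>2 *
     (p k l / (\<Sum>y\<in>UNIV. coupling v (k, l) y * p (fst y) (snd y)))"
  by (simp add: Gamma_D_def coupling_def sum_pairs)

lemma Gamma_U_coupling:
  "Gamma_U M \<rho>f \<rho>r \<tau> \<beta> v p k l = \<bar>bvec \<beta> k l \<bullet> v k l\<bar>\<^sup>2 *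
     (p k l / (\<Sum>y\<in>UNIV. coupling v y (k, l) * p (fst y) (snd y)))"
  by (simp add: Gamma_U_def coupling_def sum_pairs inner_sum_matrix_mult mult.commute)

lemma uplink_powers_exist:
  assumes v: "\<And>k l. v k l \<noteq> 0" and p: "\<And>k l. p k l > 0"
  obtains q where "\<And>k l. q k l > 0"
    "\<And>k l. Gamma_U M \<rho>f \<rho>r \<tau> \<beta> v q k l = Gamma_D M \<rho>f \<rho>r \<tau> \<beta> v p k l"
proof -
  have "p (fst x) (snd x) > 0" for x
    using p by simp
  then obtain q where q: "\<And>x. q x > 0" "\<And>x. q x / (\<Sum>y\<in>UNIV. coupling v y x * q y)
      = p (fst x) (snd x) / (\<Sum>y\<in>UNIV. coupling v x y * p (fst y) (snd y))"
    using positive_dual_weights[of "coupling v" "\<lambda>x. p (fst x) (snd x)"] coupling_pos[of v] v by blast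
  show thesis
    using q(1) that[of "\<lambda>k l. q (k, l)"] q(2)
    by (simp add: Gamma_U_coupling Gamma_D_coupling)
qed

lemma downlink_powers_exist:
  assumes v: "\<And>k l. v k l \<noteq> 0" and q: "\<And>k l. q k l > 0"
  obtains p where "\<And>k l. p k l > 0"
    "\<And>k l. Gamma_D M \<rho>f \<rho>r \<tau> \<beta> v p k l = Gamma_U M \<rho>f \<rho>r \<tau> \<beta> v q k l"
proof -
  have "q (fst x) (snd x) > 0" for x
    using q by simp
  \<comment> \<open>The same weights lemma, applied to the transposed coupling.\<close>
  then obtain p where p: "\<And>x. p x > 0" "\<And>x. p x / (\<Sum>y\<in>UNIV. coupling v x y * p y)
      = q (fst x) (snd x) / (\<Sum>y\<in>UNIV. coupling v y x * q (fst y) (snd y))"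
    using positive_dual_weights[of "\<lambda>x y. coupling v y x" "\<lambda>x. q (fst x) (snd x)"] coupling_pos[of v] v by blast
  show thesis
    using p(1) that[of "\<lambda>k l. p (k, l)"] p(2)
    by (simp add: Gamma_U_coupling Gamma_D_coupling)
qed

text \<open>An arbitrary \<open>P\<close> expresses that both systems attain the same families of
  ratios; the feasible ranges and their conditional versions are then instances.\<close>

lemma attainable_D_iff_U:
  "(\<exists>v p. admissible_D v p \<and> P (Gamma_D M \<rho>f \<rho>r \<tau> \<beta> v p))
    \<longleftrightarrow> (\<exists>w q. admissible_U w q \<and> P (Gamma_U M \<rho>f \<rho>r \<tau> \<beta> w q))"
proof
  assume "\<exists>v p. admissible_D v p \<and> P (Gamma_D M \<rho>f \<rho>r \<tau> \<beta> v p)"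
  then obtain v p where v: "\<And>k l. v k l \<noteq> 0" and p: "\<And>k l. p k l > 0"
    and P: "P (Gamma_D M \<rho>f \<rho>r \<tau> \<beta> v p)"
    by (auto simp: admissible_D_def)
  obtain q where q: "\<And>k l. q k l > 0"
    "\<And>k l. Gamma_U M \<rho>f \<rho>r \<tau> \<beta> v q k l = Gamma_D M \<rho>f \<rho>r \<tau> \<beta> v p k l"
    using uplink_powers_exist[of v p] v p by blast
  \<comment> \<open>The powers \<open>q\<close> were found for \<open>v\<close> itself; normalizing
    afterwards leaves the uplink ratios unchanged.\<close>
  have "Gamma_U M \<rho>f \<rho>r \<tau> \<beta> (\<lambda>k l. sgn (v k l)) q = Gamma_D M \<rho>f \<rho>r \<tau> \<beta> v p"
    unfolding sgn_div_norm using v q(2) by (subst Gamma_U_scale) (auto simp: fun_eq_iff)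
  moreover have "admissible_U (\<lambda>k l. sgn (v k l)) q"
    using v q(1) by (simp add: admissible_U_def norm_sgn)
  ultimately show "\<exists>w q. admissible_U w q \<and> P (Gamma_U M \<rho>f \<rho>r \<tau> \<beta> w q)"
    using P by metis
next
  assume "\<exists>w q. admissible_U w q \<and> P (Gamma_U M \<rho>f \<rho>r \<tau> \<beta> w q)"
  then obtain w q where w: "\<And>k l. norm (w k l) = 1" and q: "\<And>k l. q k l > 0"
    and P: "P (Gamma_U M \<rho>f \<rho>r \<tau> \<beta> w q)"
    by (auto simp: admissible_U_def)
  have w0: "w k l \<noteq> 0" for k l
    using w[of k l] by auto
  obtain p where p: "\<And>k l. p k l > 0"
    "\<And>k l. Gamma_D M \<rho>f \<rho>r \<tau> \<beta> w p k l = Gamma_U M \<rho>f \<rho>r \<tau> \<beta> w q k l"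
    using downlink_powers_exist[of w q] w0 q by blast
  have "Gamma_D M \<rho>f \<rho>r \<tau> \<beta> w p = Gamma_U M \<rho>f \<rho>r \<tau> \<beta> w q"
    using p(2) by (simp add: fun_eq_iff)
  moreover have "admissible_D w p"
    using w0 p(1) by (simp add: admissible_D_def)
  ultimately show "\<exists>v p. admissible_D v p \<and> P (Gamma_D M \<rho>f \<rho>r \<tau> \<beta> v p)"
    using P by metis
qed

end

theorem theorem5:
  fixes \<beta> :: "'k::finite \<Rightarrow> 'l::finite \<Rightarrow> 'l \<Rightarrow> real"
    and M :: nat and \<rho>f \<rho>r \<tau> :: real
  assumes "M > 0" and "\<rho>f > 0" and "\<rho>r > 0" and "\<tau> > 0"
    and "\<And>k l j. \<beta> k l j > 0"
  shows "(\<forall>u :: real^('k \<times> 'l). QoS u \<longrightarrow>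
            Omega_D_cond M \<rho>f \<rho>r \<tau> \<beta> u = Omega_U_cond M \<rho>f \<rho>r \<tau> \<beta> u)
       \<and> Omega_D M \<rho>f \<rho>r \<tau> \<beta> = Omega_U M \<rho>f \<rho>r \<tau> \<beta>"
proof (intro conjI allI impI)
  have iff: "(\<exists>v p. admissible_D v p \<and> P (Gamma_D M \<rho>f \<rho>r \<tau> \<beta> v p))
      \<longleftrightarrow> (\<exists>w q. admissible_U w q \<and> P (Gamma_U M \<rho>f \<rho>r \<tau> \<beta> w q))" for P
    using assms by (rule attainable_D_iff_U)
  show "Omega_D M \<rho>f \<rho>r \<tau> \<beta> = Omega_U M \<rho>f \<rho>r \<tau> \<beta>"
    unfolding Omega_D_def Omega_U_def
    by (subst iff[where P = "\<lambda>G. \<forall>k l. _ $ (k, l) \<le> G k l"]) simp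
  show "Omega_D_cond M \<rho>f \<rho>r \<tau> \<beta> u = Omega_U_cond M \<rho>f \<rho>r \<tau> \<beta> u" for u :: "real^('k \<times> 'l)"
    unfolding Omega_D_cond_def Omega_U_cond_def Gamma_bar_D_def Gamma_bar_U_def
    \<comment> \<open>The wildcard is matched with the candidate value bound by
      \<open>GREATEST\<close>, so both maxima are taken over the same predicate.\<close>
    by (subst iff[where P = "\<lambda>G. \<forall>k l. _ \<le> G k l / u $ (k, l)"]) simp
qed

end
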